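(* For every $n\ge0$, the Heat--Airy polynomial $\mathcal H_n(x,t,s)=P_{t,s}(x^n)$ satisfies $$\frac{\partial}{\partial t}\mathcal H_n=\frac12D^2\mathcal H_n,\qquad \frac{\partial}{\partial s}\mathcal H_n=-\frac13D^3\mathcal H_n .$$
   Context: $D=\partial/\partial x$. $P_{t,s}=\exp\left(\frac t2D^2-\frac s3D^3\right)$ acts on polynomials in $x$ by its exponential series (a finite sum on each polynomial), $t,s\ge0$; $\mathcal H_n$ is a polynomial in $(x,t,s)$ and the partial derivatives are those of this polynomial. *)

theory Defs
  imports Complex_Main "HOL-Computational_Algebra.Polynomial" "HOL-Library.Groups_Big_Fun"
begin

definition heat_airy_gen :: "real \<Rightarrow> real \<Rightarrow> real poly \<Rightarrow> real poly" where
  "heat_airy_gen t s p = smult (t / 2) ((pderiv ^^ 2) p) - smult (s / 3) ((pderiv ^^ 3) p)"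

text \<open>The exponential series of the generator. \<^const>\<open>Sum_any\<close> sums over all exponents
  \<open>k\<close> with a nonzero term; there are finitely many of them by \<open>finite_heat_airy_terms\<close> below.\<close>

definition heat_airy_op :: "real \<Rightarrow> real \<Rightarrow> real poly \<Rightarrow> real poly" where
  "heat_airy_op t s p = Sum_any (\<lambda>k. smult (1 / fact k) ((heat_airy_gen t s ^^ k) p))"

lemma heat_airy_gen_0 [simp]: "heat_airy_gen t s 0 = 0"
  by (simp add: heat_airy_gen_def numeral_eq_Suc)

lemma heat_airy_gen_funpow_0 [simp]: "(heat_airy_gen t s ^^ k) 0 = 0"
  by (induction k) auto

lemma degree_heat_airy_gen: "degree (heat_airy_gen t s p) \<le> degree p - 1"
  unfolding heat_airy_gen_def
  by (rule degree_diff_le; rule order_trans[OF degree_smult_le])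
     (simp_all add: numeral_eq_Suc degree_pderiv)

lemma heat_airy_gen_nilpotent: "degree p < k \<Longrightarrow> (heat_airy_gen t s ^^ k) p = 0"
proof (induction k arbitrary: p)
  case (Suc k)
  show ?case
  proof (cases "degree p = 0")
    case True
    then have "pderiv p = 0" by (simp add: pderiv_eq_0_iff)
    then have "heat_airy_gen t s p = 0" by (simp add: heat_airy_gen_def numeral_eq_Suc)
    then show ?thesis by (simp add: funpow_swap1)
  next
    case False
    then have "degree (heat_airy_gen t s p) < k"
      using Suc.prems degree_heat_airy_gen[of t s p] by linarith
    then show ?thesis using Suc.IH by (simp add: funpow_swap1)
  qed
qed simp

lemma finite_heat_airy_terms:
  "finite {k. smult (1 / fact k) ((heat_airy_gen t s ^^ k) p) \<noteq> 0}"
  by (rule finite_subset[of _ "{..degree p}"])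
     (auto simp: not_less[symmetric] dest: heat_airy_gen_nilpotent)

lemma heat_airy_op_eq_sum:
  "heat_airy_op t s p = (\<Sum>k\<le>degree p. smult (1 / fact k) ((heat_airy_gen t s ^^ k) p))"
  unfolding heat_airy_op_def
  by (rule Sum_any.expand_superset)
     (auto simp: not_less[symmetric] dest: heat_airy_gen_nilpotent)

text \<open>A polynomial in \<open>x\<close>, \<open>t\<close>, \<open>s\<close> is an element of \<open>\<real>[s][t][x]\<close>: the outermost variable of
  the type is \<open>x\<close>, the middle one \<open>t\<close>, the innermost one \<open>s\<close>.  Hence \<open>D\<close> is \<^const>\<open>pderiv\<close> itself,
  while the derivatives in the other two variables act on coefficients.\<close>

type_synonym poly_xts = "real poly poly poly"

definition partial_t :: "poly_xts \<Rightarrow> poly_xts" where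
  "partial_t H = map_poly pderiv H"

definition partial_s :: "poly_xts \<Rightarrow> poly_xts" where
  "partial_s H = map_poly (map_poly pderiv) H"

definition specialize_ts :: "real \<Rightarrow> real \<Rightarrow> poly_xts \<Rightarrow> real poly" where
  "specialize_ts t s H = map_poly (\<lambda>c. poly (poly c [:t:]) s) H"

text \<open>The one polynomial in \<open>x\<close>, \<open>t\<close>, \<open>s\<close> whose value at all \<open>t, s \<ge> 0\<close> is the image of
  \<open>x\<^sup>n\<close> under the operator; existence and uniqueness are \<open>ex1_heat_airy_poly\<close> below.\<close>

definition heat_airy_poly :: "nat \<Rightarrow> poly_xts" where
  "heat_airy_poly n =
     (THE H. \<forall>t\<ge>0. \<forall>s\<ge>0. specialize_ts t s H = heat_airy_op t s (monom 1 n))"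

lemma coeff_specialize_ts:
  "coeff (specialize_ts t s H) i = poly (poly (coeff H i) [:t:]) s"
  by (simp add: specialize_ts_def coeff_map_poly)

lemma specialize_ts_add: "specialize_ts t s (F + G) = specialize_ts t s F + specialize_ts t s G"
  by (rule poly_eqI) (simp add: coeff_specialize_ts)

lemma specialize_ts_diff: "specialize_ts t s (F - G) = specialize_ts t s F - specialize_ts t s G"
  by (rule poly_eqI) (simp add: coeff_specialize_ts)

lemma specialize_ts_smult:
  "specialize_ts t s (smult c F) = smult (poly (poly c [:t:]) s) (specialize_ts t s F)"
  by (rule poly_eqI) (simp add: coeff_specialize_ts)

lemma specialize_ts_0: "specialize_ts t s 0 = 0"
  by (simp add: specialize_ts_def)

lemma specialize_ts_sum:
  "specialize_ts t s (\<Sum>k\<in>A. F k) = (\<Sum>k\<in>A. specialize_ts t s (F k))"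
  by (induction A rule: infinite_finite_induct) (auto simp: specialize_ts_add specialize_ts_0)

lemma specialize_ts_pderiv: "specialize_ts t s (pderiv F) = pderiv (specialize_ts t s F)"
  by (rule poly_eqI) (simp add: coeff_specialize_ts coeff_pderiv of_nat_poly)

lemma ex_specialize_ts_funpow:
  "\<exists>F. \<forall>t s. specialize_ts t s F = (heat_airy_gen t s ^^ k) p"
proof (induction k)
  case 0
  have "specialize_ts t s (map_poly (\<lambda>c. [:[:c:]:]) p) = p" for t s
    by (rule poly_eqI) (simp add: coeff_specialize_ts coeff_map_poly)
  then show ?case by auto
next
  case (Suc k)
  then obtain F where F: "\<And>t s. specialize_ts t s F = (heat_airy_gen t s ^^ k) p" by auto
  define G where "G = smult [:0, [:1/2:]:] ((pderiv ^^ 2) F) - smult [:[:0, 1/3:]:] ((pderiv ^^ 3) F)"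
  have "specialize_ts t s G = (heat_airy_gen t s ^^ Suc k) p" for t s
    by (simp add: G_def specialize_ts_diff specialize_ts_smult specialize_ts_pderiv F
        heat_airy_gen_def numeral_eq_Suc)
  then show ?case by blast
qed

lemma ex_specialize_ts_heat_airy_op:
  "\<exists>F. \<forall>t s. specialize_ts t s F = heat_airy_op t s p"
proof -
  obtain F where F: "\<And>k t s. specialize_ts t s (F k) = (heat_airy_gen t s ^^ k) p"
    using ex_specialize_ts_funpow[of _ p] by metis
  have "specialize_ts t s (\<Sum>k\<le>degree p. smult [:[:1 / fact k:]:] (F k)) = heat_airy_op t s p" for t s
    by (simp add: heat_airy_op_eq_sum specialize_ts_sum specialize_ts_smult F)
  then show ?thesis by blast
qed

lemma specialize_ts_inj:
  assumes eq: "\<And>t s. t \<ge> 0 \<Longrightarrow> s \<ge> 0 \<Longrightarrow> specialize_ts t s F = specialize_ts t s G"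
  shows "F = G"
proof (rule poly_eqI)
  fix i
  define c where "c = coeff F i - coeff G i"
  have inf: "infinite {0::real..}" by (rule infinite_Ici)
  have z: "poly (poly c [:t:]) s = 0" if "t \<ge> 0" "s \<ge> 0" for t s
    using arg_cong[OF eq[OF that], of "\<lambda>p. coeff p i"]
    by (simp add: coeff_specialize_ts c_def)
  have r: "poly c [:t:] = 0" if "t \<ge> 0" for t
  proof (rule ccontr)
    assume "poly c [:t:] \<noteq> 0"
    then have "finite {s. poly (poly c [:t:]) s = 0}" by (rule poly_roots_finite)
    then have "finite {0::real..}" by (rule finite_subset[rotated]) (use z that in auto)
    then show False using inf by simp
  qed
  have "c = 0"
  proof (rule ccontr)
    assume "c \<noteq> 0"
    then have "finite {x. poly c x = 0}" by (rule poly_roots_finite)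
    then have "finite ((\<lambda>t. [:t:]) ` {0::real..})" by (rule finite_subset[rotated]) (use r in auto)
    then have "finite {0::real..}" by (rule finite_imageD) (auto simp: inj_on_def)
    then show False using inf by simp
  qed
  then show "coeff F i = coeff G i" by (simp add: c_def)
qed

lemma ex1_heat_airy_poly:
  "\<exists>!H. \<forall>t\<ge>0. \<forall>s\<ge>0. specialize_ts t s H = heat_airy_op t s (monom 1 n)"
  using ex_specialize_ts_heat_airy_op[of "monom 1 n"] by (auto intro!: specialize_ts_inj)

lemma specialize_heat_airy_poly:
  "t \<ge> 0 \<Longrightarrow> s \<ge> 0 \<Longrightarrow>
     specialize_ts t s (heat_airy_poly n) = heat_airy_op t s (monom 1 n)"
  using theI'[OF ex1_heat_airy_poly, of n] by (simp add: heat_airy_poly_def)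

end

theory Submission
  imports Defs
begin

text \<open>The generator \<open>G = (t/2) D\<^sup>2 - (s/3) D\<^sup>3\<close> acts on polynomials in \<open>x\<close>, \<open>t\<close>, \<open>s\<close>, and its
  commutators with \<open>\<partial>/\<partial>t\<close> and \<open>\<partial>/\<partial>s\<close> are \<open>E = D\<^sup>2/2\<close> and \<open>E = -D\<^sup>3/3\<close>, which commute with \<open>G\<close>.  As
  \<open>x\<^sup>n\<close> depends on neither \<open>t\<close> nor \<open>s\<close>, the derivative of \<open>G\<^sup>k x\<^sup>n\<close> is \<open>k E G\<^sup>k\<^sup>-\<^sup>1 x\<^sup>n\<close>, so that of
  the exponential series at \<open>x\<^sup>n\<close> is \<open>E\<close> applied to the series.\<close>

lemma additive_of_nat_mult:
  fixes G :: "'a::semiring_1 \<Rightarrow> 'b::ring_1"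
  assumes "\<And>x y. G (x + y) = G x + G y"
  shows "G (of_nat k * x) = of_nat k * G x"
proof (induction k)
  case 0
  show ?case using assms[of 0 0] by simp
next
  case (Suc k)
  then show ?case by (simp add: distrib_right assms)
qed

text \<open>Each of the \<open>Suc k\<close> factors \<open>G\<close> that \<open>d\<close> passes
  contributes one \<open>E\<close>; since \<open>E\<close> commutes with \<open>G\<close>, these
  contributions are equal, and what is left over vanishes with \<open>d x\<close>.\<close>

lemma commutator_funpow:
  fixes G :: "'a::ring_1 \<Rightarrow> 'a"
  assumes G_add: "\<And>x y. G (x + y) = G x + G y"
    and dG: "\<And>x. d (G x) = G (d x) + E x"
    and EG: "\<And>x. E (G x) = G (E x)"
    and d0: "d x = 0"
  shows "d ((G ^^ Suc k) x) = of_nat (Suc k) * E ((G ^^ k) x)"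
proof (induction k)
  case 0
  have "G 0 = 0" using G_add[of 0 0] by simp
  then show ?case by (simp add: dG d0)
next
  case (Suc k)
  have "d ((G ^^ Suc (Suc k)) x) = G (d ((G ^^ Suc k) x)) + E ((G ^^ Suc k) x)"
    by (simp add: dG)
  also have "\<dots> = of_nat (Suc k) * G (E ((G ^^ k) x)) + E ((G ^^ Suc k) x)"
    by (simp only: Suc.IH additive_of_nat_mult[of G, OF G_add])
  also have "G (E ((G ^^ k) x)) = E ((G ^^ Suc k) x)"
    by (simp add: EG)
  finally show ?case by (simp add: algebra_simps)
qed

lemma coeff_partial_t: "coeff (partial_t F) i = pderiv (coeff F i)"
  by (simp add: partial_t_def coeff_map_poly)

lemma coeff_partial_s: "coeff (partial_s F) i = map_poly pderiv (coeff F i)"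
  by (simp add: partial_s_def coeff_map_poly)

lemma map_poly_pderiv_add:
  "map_poly pderiv (p + q) = map_poly pderiv p + map_poly pderiv (q :: 'a::idom poly poly)"
  by (rule poly_eqI) (simp add: coeff_map_poly pderiv_add)

text \<open>Each coefficient of a product is a finite convolution sum, to which the ordinary Leibniz
  rule applies termwise.\<close>

lemma map_poly_pderiv_mult:
  "map_poly pderiv (p * q) = map_poly pderiv p * q + p * map_poly pderiv (q :: 'a::idom poly poly)"
  by (rule poly_eqI)
    (simp add: coeff_map_poly coeff_mult higher_pderiv_sum[of 1, simplified] pderiv_mult sum.distrib,
      simp add: algebra_simps)

lemma partial_t_add: "partial_t (F + G) = partial_t F + partial_t G"
  by (rule poly_eqI) (simp add: coeff_partial_t pderiv_add)

lemma partial_s_add: "partial_s (F + G) = partial_s F + partial_s G"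
  by (rule poly_eqI) (simp add: coeff_partial_s map_poly_pderiv_add)

lemma partial_t_smult: "partial_t (smult c F) = smult (pderiv c) F + smult c (partial_t F)"
  by (rule poly_eqI) (simp add: coeff_partial_t pderiv_mult algebra_simps)

lemma partial_s_smult: "partial_s (smult c F) = smult (map_poly pderiv c) F + smult c (partial_s F)"
  by (rule poly_eqI) (simp add: coeff_partial_s map_poly_pderiv_mult algebra_simps)

lemma partial_t_pderiv: "partial_t (pderiv F) = pderiv (partial_t F)"
  by (rule poly_eqI) (simp add: coeff_partial_t coeff_pderiv pderiv_mult del: of_nat_Suc)

lemma partial_s_pderiv: "partial_s (pderiv F) = pderiv (partial_s F)"
proof (rule poly_eqI)
  fix i
  \<comment> \<open>Natural numbers are constant in \<open>s\<close>, so the factor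
    \<open>Suc i\<close> from \<open>coeff_pderiv\<close> adds no term to the product rule.\<close>
  have "map_poly pderiv (of_nat k :: real poly poly) = 0" for k
    by (simp add: of_nat_poly map_poly_pCons pderiv_pCons)
  from this[of "Suc i"] show "coeff (partial_s (pderiv F)) i = coeff (pderiv (partial_s F)) i"
    by (simp add: coeff_partial_s coeff_pderiv map_poly_pderiv_mult del: of_nat_Suc)
qed

text \<open>Here \<open>t\<close> and \<open>s\<close> are variables of the coefficient ring:
  \<open>[:0, [:1/2:]:]\<close> is t/2 and \<open>[:[:0, 1/3:]:]\<close> is s/3.\<close>

definition heat_airy_gen_xts :: "poly_xts \<Rightarrow> poly_xts" where
  "heat_airy_gen_xts F =
     smult [:0, [:1/2:]:] ((pderiv ^^ 2) F) - smult [:[:0, 1/3:]:] ((pderiv ^^ 3) F)"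

lemma specialize_ts_gen_funpow:
  "specialize_ts t s ((heat_airy_gen_xts ^^ k) F) = (heat_airy_gen t s ^^ k) (specialize_ts t s F)"
  by (induction k)
    (simp_all add: heat_airy_gen_xts_def specialize_ts_diff specialize_ts_smult specialize_ts_pderiv
      heat_airy_gen_def numeral_eq_Suc)

lemma heat_airy_gen_xts_add:
  "heat_airy_gen_xts (F + G) = heat_airy_gen_xts F + heat_airy_gen_xts G"
  by (simp add: heat_airy_gen_xts_def numeral_eq_Suc pderiv_add smult_add_right)

lemma heat_airy_gen_xts_smult:
  "heat_airy_gen_xts (smult c F) = smult c (heat_airy_gen_xts F)"
  by (simp add: heat_airy_gen_xts_def numeral_eq_Suc pderiv_smult smult_diff_right mult.commute)

lemma heat_airy_gen_xts_pderiv: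
  "heat_airy_gen_xts (pderiv F) = pderiv (heat_airy_gen_xts F)"
  by (simp add: heat_airy_gen_xts_def numeral_eq_Suc pderiv_smult pderiv_diff)

lemma partial_t_gen:
  "partial_t (heat_airy_gen_xts F) =
     heat_airy_gen_xts (partial_t F) + smult [:[:1/2:]:] ((pderiv ^^ 2) F)"
proof -
  \<comment> \<open>With the sign moved into the coefficient, additivity and the product rule of
    \<open>partial_t\<close> apply directly.\<close>
  have "heat_airy_gen_xts F =
      smult [:0, [:1/2:]:] ((pderiv ^^ 2) F) + smult [:[:0, -1/3:]:] ((pderiv ^^ 3) F)" for F
    by (simp add: heat_airy_gen_xts_def flip: smult_minus_left)
  then show ?thesis
    by (simp add: partial_t_add partial_t_smult partial_t_pderiv numeral_eq_Suc pderiv_pCons)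
qed

lemma partial_s_gen:
  "partial_s (heat_airy_gen_xts F) =
     heat_airy_gen_xts (partial_s F) + smult [:[:-1/3:]:] ((pderiv ^^ 3) F)"
proof -
  have "heat_airy_gen_xts F =
      smult [:0, [:1/2:]:] ((pderiv ^^ 2) F) + smult [:[:0, -1/3:]:] ((pderiv ^^ 3) F)" for F
    by (simp add: heat_airy_gen_xts_def flip: smult_minus_left)
  then show ?thesis
    by (simp add: partial_s_add partial_s_smult partial_s_pderiv numeral_eq_Suc pderiv_pCons
        map_poly_pCons)
qed

lemma specialize_ts_monom: "specialize_ts t s (monom 1 n) = monom 1 n"
  by (rule poly_eqI) (simp add: coeff_specialize_ts)

text \<open>Nilpotency holds for all real parameters, and a polynomial is determined by its values
  at \<open>t\<close>, \<open>s\<close> \<ge> 0.\<close>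

lemma heat_airy_gen_xts_nilpotent: "(heat_airy_gen_xts ^^ Suc n) (monom 1 n) = 0"
  by (rule specialize_ts_inj)
    (simp only: specialize_ts_gen_funpow specialize_ts_monom specialize_ts_0,
      simp add: heat_airy_gen_nilpotent degree_monom_eq del: funpow.simps)

text \<open>Makes the definite description concrete: for \<open>t\<close>, \<open>s\<close> \<ge> 0
  both sides specialize to the exponential series, which may be cut off at the degree
  \<open>n\<close>.\<close>

lemma heat_airy_poly_eq_sum:
  "heat_airy_poly n =
     (\<Sum>k\<le>n. smult [:[:1 / fact k:]:] ((heat_airy_gen_xts ^^ k) (monom 1 n)))"
  by (rule specialize_ts_inj)
    (simp add: specialize_heat_airy_poly specialize_ts_sum specialize_ts_smult
      specialize_ts_gen_funpow specialize_ts_monom heat_airy_op_eq_sum degree_monom_eq)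

text \<open>Serves both variables: \<open>d\<close> stands for a partial derivative,
  \<open>E\<close> for its commutator with the generator.\<close>

lemma derivation_heat_airy_poly:
  fixes d E :: "poly_xts \<Rightarrow> poly_xts"
  assumes d_add: "\<And>F G. d (F + G) = d F + d G"
    and d_smult: "\<And>c F. d (smult [:[:c:]:] F) = smult [:[:c:]:] (d F)"
    and E_add: "\<And>F G. E (F + G) = E F + E G"
    and E_smult: "\<And>c F. E (smult [:[:c:]:] F) = smult [:[:c:]:] (E F)"
    and dG: "\<And>F. d (heat_airy_gen_xts F) = heat_airy_gen_xts (d F) + E F"
    and EG: "\<And>F. E (heat_airy_gen_xts F) = heat_airy_gen_xts (E F)"
    and d_monom: "d (monom 1 n) = 0"
  shows "d (heat_airy_poly n) = E (heat_airy_poly n)"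
proof -
  define X where "X k = (heat_airy_gen_xts ^^ k) (monom 1 n)" for k
  define T where "T k = smult [:[:1 / fact k:]:] (X k)" for k
  have d0: "d 0 = 0" and E0: "E 0 = 0"
    using d_add[of 0 0] E_add[of 0 0] by simp_all
  have d_sum: "d (sum F A) = (\<Sum>k\<in>A. d (F k))" and E_sum: "E (sum F A) = (\<Sum>k\<in>A. E (F k))"
    for F and A :: "nat set"
    by (induction A rule: infinite_finite_induct) (simp_all add: d0 E0 d_add E_add)
  have H: "heat_airy_poly n = (\<Sum>k\<le>n. T k)"
    by (simp add: T_def X_def heat_airy_poly_eq_sum)
  have T_last: "T (Suc n) = 0"
    unfolding T_def X_def heat_airy_gen_xts_nilpotent by simp
  have d_T_0: "d (T 0) = 0"
    by (simp add: T_def X_def d_smult d_monom)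
  \<comment> \<open>The factor \<open>Suc k\<close> from the commutator turns
    \<open>1 / fact (Suc k)\<close> into \<open>1 / fact k\<close>.\<close>
  have d_T: "d (T (Suc k)) = E (T k)" for k
  proof -
    have "d (X (Suc k)) = of_nat (Suc k) * E (X k)"
      unfolding X_def
      by (rule commutator_funpow[OF heat_airy_gen_xts_add dG EG d_monom])
    also have "\<dots> = smult [:[:of_nat (Suc k):]:] (E (X k))"
      by (simp only: of_nat_poly) simp
    finally show ?thesis
      by (simp add: T_def d_smult E_smult del: of_nat_Suc)
  qed
  \<comment> \<open>The zero term \<open>T (Suc n)\<close> is appended so that, once
    \<open>d (T 0)\<close> drops out, the index shift yields a full sum up to
    \<open>n\<close>.\<close>
  have "d (heat_airy_poly n) = d (\<Sum>k\<le>Suc n. T k)"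
    by (simp add: H T_last)
  also have "\<dots> = (\<Sum>k\<le>n. E (T k))"
    unfolding sum.atMost_Suc_shift by (simp add: d_add d_sum d_T_0 d_T)
  also have "\<dots> = E (heat_airy_poly n)"
    by (simp add: H E_sum)
  finally show ?thesis .
qed

theorem proposition3p5:
  fixes n :: nat
  shows "partial_t (heat_airy_poly n) = smult [:[:1/2:]:] ((pderiv ^^ 2) (heat_airy_poly n)) \<and>
         partial_s (heat_airy_poly n) = smult [:[:-1/3:]:] ((pderiv ^^ 3) (heat_airy_poly n))"
proof
  show "partial_t (heat_airy_poly n) = smult [:[:1/2:]:] ((pderiv ^^ 2) (heat_airy_poly n))"
  \<comment> \<open>\<open>partial_t_gen\<close> fixes \<open>E\<close> as half the second
    derivative in \<open>x\<close>.\<close>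
  proof (rule derivation_heat_airy_poly[OF partial_t_add _ _ _ partial_t_gen])
    show "partial_t (monom 1 n) = 0"
      by (rule poly_eqI) (simp add: coeff_partial_t)
  qed (simp_all add: partial_t_smult pderiv_pCons pderiv_add pderiv_smult smult_add_right
      heat_airy_gen_xts_smult heat_airy_gen_xts_pderiv numeral_eq_Suc mult.commute)
  show "partial_s (heat_airy_poly n) = smult [:[:-1/3:]:] ((pderiv ^^ 3) (heat_airy_poly n))"
  proof (rule derivation_heat_airy_poly[OF partial_s_add _ _ _ partial_s_gen])
    show "partial_s (monom 1 n) = 0"
      by (rule poly_eqI) (simp add: coeff_partial_s map_poly_pCons one_pCons)
  qed (simp_all add: partial_s_smult map_poly_pCons pderiv_pCons pderiv_add pderiv_smult smult_add_right
      heat_airy_gen_xts_smult heat_airy_gen_xts_pderiv numeral_eq_Suc mult.commute)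
qed

end
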